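(* Let $n\in\mathbb{N}$, and let $X=(x_{\ell,j})\in\{0,1\}^{n\times(2^n-1)}$ be the matrix whose $j$-th column ($j=1,\ldots,2^n-1$) contains the binary representation of $j$, i.e. $j=\sum_{\ell=1}^n x_{\ell,j}2^{\ell-1}$ with $x_{\ell,j}\in\{0,1\}$. Let $K=X^TX$. Then for every $d\in\mathbb{N}$ $$\operatorname{rank} K^{\circ d}=\begin{cases}\displaystyle\sum_{p=1}^d\binom{n}{p}, & \text{if } d\le n,\\[2mm] 2^n-1, & \text{if } d\ge n.\end{cases}$$
   Context: $\mathbb{N}=\{1,2,3,\ldots\}$. For a real matrix $A=(a_{ij})$ and $d\in\mathbb{N}$, the $d$-th Hadamard power is the entrywise power $A^{\circ d}=(a_{ij}^d)$. *)

theory Defs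
  imports "Jordan_Normal_Form.DL_Rank"
begin

definition hadamard_power :: "'a::monoid_mult mat \<Rightarrow> nat \<Rightarrow> 'a mat" where
  "hadamard_power A d = map_mat (\<lambda>a. a ^ d) A"

text \<open>
  Library matrices are indexed from 0, so the column with index j stands for the number j + 1
  and the row with index l carries the binary weight \<open>2 ^ l\<close>.
\<close>

definition binary_matrix :: "nat \<Rightarrow> real mat \<Rightarrow> bool" where
  "binary_matrix n X \<longleftrightarrow>
     X \<in> carrier_mat n (2 ^ n - 1) \<and>
     (\<forall>l<n. \<forall>j<2 ^ n - 1. X $$ (l, j) \<in> {0, 1}) \<and>
     (\<forall>j<2 ^ n - 1. real (j + 1) = (\<Sum>l<n. X $$ (l, j) * 2 ^ l))"

lemma binary_matrix_exists: "\<exists>X. binary_matrix n X"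
proof
  let ?X = "mat n (2 ^ n - 1) (\<lambda>(l, j). of_bool (bit (j + 1) l)) :: real mat"
  have "real (j + 1) = (\<Sum>l<n. ?X $$ (l, j) * 2 ^ l)" if j: "j < 2 ^ n - 1" for j
  proof -
    have "j + 1 < 2 ^ n"
      using j by linarith
    then have "take_bit n (j + 1) = j + 1"
      by (simp only: take_bit_nat_eq_self_iff)
    then have "j + 1 = (\<Sum>l<n. of_bool (bit (j + 1) l) * 2 ^ l)"
      using take_bit_sum[of n "j + 1"] by (simp add: push_bit_eq_mult atLeast0LessThan)
    then have "real (j + 1) = real (\<Sum>l<n. of_bool (bit (j + 1) l) * 2 ^ l)"
      by (rule arg_cong)
    also have "\<dots> = (\<Sum>l<n. of_bool (bit (j + 1) l) * 2 ^ l)"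
      by (simp only: of_nat_sum of_nat_mult of_nat_of_bool of_nat_power of_nat_numeral)
    also have "\<dots> = (\<Sum>l<n. ?X $$ (l, j) * 2 ^ l)"
      using j by (intro sum.cong) auto
    finally show ?thesis .
  qed
  then show "binary_matrix n ?X"
    by (auto simp: binary_matrix_def)
qed

end

theory Submission
  imports Defs
begin

text \<open>
  Let \<open>S j \<subseteq> {..<n}\<close> be the set of positions of the binary ones of \<open>j + 1\<close>, so that
  \<open>S\<close> enumerates the nonempty subsets of \<open>{..<n}\<close> and the entry of \<open>K\<close> at \<open>(i, j)\<close> is
  \<open>card (S i \<inter> S j)\<close>. Its \<open>d\<close>-th power counts the words of length \<open>d\<close> over the alphabet
  \<open>S i \<inter> S j\<close>. Sorting these words by the set \<open>T\<close> of letters that occur in them gives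
  \<open>card (S i \<inter> S j) ^ d = (\<Sum>T. w T * [T \<subseteq> S i] * [T \<subseteq> S j])\<close>, where \<open>w T\<close> is the number of
  words of length \<open>d\<close> in which exactly the letters of \<open>T\<close> occur.

  In matrix form this is a congruence \<open>Z\<^sup>T D Z\<close>: here \<open>Z\<close> is the inclusion matrix of the
  nonempty subsets, and \<open>D\<close> is diagonal with the entries \<open>w T\<close>. A proper subset has a smaller binary
  value, so \<open>Z\<close> is unitriangular (\<open>det_inclusion_matrix\<close>), and the rank is the number of \<open>T\<close>
  with \<open>w T \<noteq> 0\<close> (\<open>rank_congruent_diag\<close>). These are the nonempty \<open>T\<close> with at most \<open>d\<close>
  elements (\<open>words_onto_eq_0_iff\<close>); counting them by cardinality gives the formula.
\<close>

section \<open>The rank of a matrix congruent to a diagonal one\<close>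

lemma (in vec_space) rank_sum_products_le:
  fixes f g :: "'b \<Rightarrow> nat \<Rightarrow> 'a"
  assumes "finite I"
  shows "rank (mat n nc (\<lambda>(i, j). \<Sum>t\<in>I. f t i * g t j)) \<le> card I"
  using assms
proof (induction I rule: finite_induct)
  case empty
  have "mat n nc (\<lambda>(i, j). \<Sum>t\<in>{}. f t i * g t j) = 0\<^sub>m n nc"
    by (rule eq_matI) auto
  then show ?case
    by (simp only: rank_0I card.empty)
next
  case (insert t I)
  let ?A = "mat n nc (\<lambda>(i, j). f t i * g t j)"
  let ?B = "mat n nc (\<lambda>(i, j). \<Sum>t\<in>I. f t i * g t j)"
  have "mat n nc (\<lambda>(i, j). \<Sum>t\<in>insert t I. f t i * g t j) = ?A + ?B"
    using insert.hyps by (intro eq_matI) auto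
  moreover have "rank (?A + ?B) \<le> rank ?A + rank ?B"
    by (rule rank_subadditive[where nc = nc]) auto
  moreover have "rank ?A \<le> 1"
    by (rule rank_le_1_product_entries[where nc = nc and f = "f t" and g = "g t"]) auto
  ultimately show ?case
    using insert by simp
qed

lemma congruent_diag_eq_mat:
  fixes Z :: "'a::comm_semiring_1 mat"
  assumes "Z \<in> carrier_mat m k"
  shows "Z\<^sup>T * (mat_diag m w * Z) = mat k k (\<lambda>(i, j). \<Sum>t<m. w t * Z $$ (t, i) * Z $$ (t, j))"
  using assms
  by (subst mat_diag_mult_left[OF assms])
    (auto intro!: eq_matI sum.cong simp: scalar_prod_def atLeast0LessThan mult_ac)

text \<open>
  The summands with \<open>w t = 0\<close> drop out, so the rank is at most the number \<open>r\<close> of nonzero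
  weights. For the other direction, replace the zero weights by 1: this adds a matrix of rank
  at most \<open>n - r\<close> and makes the determinant nonzero, so by subadditivity the rank
  was at least \<open>r\<close>.
\<close>

lemma (in vec_space) rank_congruent_diag:
  assumes Z: "Z \<in> carrier_mat n n" and det: "det Z \<noteq> 0"
  shows "rank (Z\<^sup>T * (mat_diag n w * Z)) = card {t. t < n \<and> w t \<noteq> 0}"
proof -
  let ?M = "\<lambda>v. Z\<^sup>T * (mat_diag n v * Z)"
  have carrier: "?M v \<in> carrier_mat n n" for v
    using Z by (meson mat_diag_dim mult_carrier_mat transpose_carrier_mat)
  have upper: "rank (?M v) \<le> card {t. t < n \<and> v t \<noteq> 0}" for v
  proof -
    have "?M v = mat n n (\<lambda>(i, j). \<Sum>t\<in>{t. t < n \<and> v t \<noteq> 0}. (v t * Z $$ (t, i)) * Z $$ (t, j))"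
      unfolding congruent_diag_eq_mat[OF Z]
      by (rule cong_mat) (auto intro!: sum.mono_neutral_right)
    then show ?thesis
      using rank_sum_products_le[of "{t. t < n \<and> v t \<noteq> 0}" n "\<lambda>t i. v t * Z $$ (t, i)"
          "\<lambda>t j. Z $$ (t, j)"] by simp
  qed
  define u :: "nat \<Rightarrow> 'a" where "u t = (if w t = 0 then 1 else 0)" for t
  have "?M (\<lambda>t. w t + u t) = ?M w + ?M u"
    unfolding congruent_diag_eq_mat[OF Z]
    by (rule eq_matI) (auto simp: sum.distrib distrib_right)
  moreover have "rank (?M (\<lambda>t. w t + u t)) = n"
  proof (rule low_rank_det_zero[OF carrier])
    have "det (mat_diag n (\<lambda>t. w t + u t)) = (\<Prod>t = 0..<n. w t + u t)"
      by (subst det_upper_triangular[where n = n])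
        (auto simp: mat_diag_def prod_list_diag_prod)
    moreover have "w t + u t \<noteq> 0" for t
      by (simp add: u_def)
    ultimately have "det (mat_diag n (\<lambda>t. w t + u t)) \<noteq> 0"
      by simp
    then show "det (?M (\<lambda>t. w t + u t)) \<noteq> 0"
      using Z det
      by (simp add: det_mult[of _ n] det_transpose[OF Z] mult_carrier_mat[of _ n n _ n])
  qed
  ultimately have "n \<le> rank (?M w) + rank (?M u)"
    using rank_subadditive[OF carrier carrier, of w u] by simp
  moreover have "rank (?M u) \<le> n - card {t. t < n \<and> w t \<noteq> 0}"
  proof -
    have "{t. t < n \<and> u t \<noteq> 0} = {..<n} - {t. t < n \<and> w t \<noteq> 0}"
      by (auto simp: u_def)
    then have "card {t. t < n \<and> u t \<noteq> 0} = n - card {t. t < n \<and> w t \<noteq> 0}"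
      by (simp add: card_Diff_subset subset_iff)
    then show ?thesis
      using upper[of u] by simp
  qed
  moreover have "card {t. t < n \<and> w t \<noteq> 0} \<le> n"
    using card_mono[of "{..<n}" "{t. t < n \<and> w t \<noteq> 0}"] by (simp add: subset_iff)
  ultimately show ?thesis
    using upper[of w] by linarith
qed

section \<open>Counting words by the letters that occur in them\<close>

text \<open>The number of surjections from a \<open>d\<close>-element set onto \<open>T\<close>, written as words.\<close>

definition words_onto :: "nat \<Rightarrow> 'a set \<Rightarrow> nat" where
  "words_onto d T = card {xs. set xs = T \<and> length xs = d}"

lemma card_power_eq_sum_words_onto:
  assumes "finite C"
  shows "card C ^ d = (\<Sum>T\<in>Pow C. words_onto d T)"
proof -
  have eq: "{xs. set xs \<subseteq> C \<and> length xs = d} = (\<Union>T\<in>Pow C. {xs. set xs = T \<and> length xs = d})"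
    by auto
  have fin: "finite {xs. set xs = T \<and> length xs = d}" if "T \<in> Pow C" for T
    using that by (intro finite_subset[OF _ finite_lists_length_eq[OF assms, of d]]) auto
  have "card C ^ d = card {xs. set xs \<subseteq> C \<and> length xs = d}"
    using card_lists_length_eq[OF assms] by simp
  also have "\<dots> = (\<Sum>T\<in>Pow C. words_onto d T)"
    unfolding eq words_onto_def using assms fin by (intro card_UN_disjoint) auto
  finally show ?thesis .
qed

lemma words_onto_eq_0_iff:
  assumes "finite T" and "d \<ge> 1"
  shows "words_onto d T = 0 \<longleftrightarrow> T = {} \<or> d < card T"
proof -
  have "finite {xs. set xs = T \<and> length xs = d}"
    by (rule finite_subset[OF _ finite_lists_length_eq[OF assms(1), of d]]) auto
  then have "words_onto d T = 0 \<longleftrightarrow> (\<nexists>xs. set xs = T \<and> length xs = d)"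
    by (auto simp: words_onto_def)
  also have "\<dots> \<longleftrightarrow> T = {} \<or> d < card T"
  proof
    assume none: "\<nexists>xs. set xs = T \<and> length xs = d"
    show "T = {} \<or> d < card T"
    proof (rule ccontr)
      assume "\<not> (T = {} \<or> d < card T)"
      then obtain a where "a \<in> T" and le: "card T \<le> d"
        by auto
      obtain ys where "set ys = T" "length ys = card T"
        using assms(1) by (metis distinct_card finite_distinct_list)
      then have "set (ys @ replicate (d - card T) a) = T \<and>
          length (ys @ replicate (d - card T) a) = d"
        using \<open>a \<in> T\<close> le by (auto simp: set_replicate_conv_if)
      then show False
        using none by blast
    qed
  next
    assume small: "T = {} \<or> d < card T"
    have "length xs \<noteq> d" if "set xs = T" for xs
    proof (cases "T = {}")
      case True
      with that show ?thesis
        using assms(2) by simp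
    next
      case False
      with small that have "length xs < card (set xs) \<or> length xs \<noteq> d"
        by blast
      then show ?thesis
        using card_length[of xs] by linarith
    qed
    then show "\<nexists>xs. set xs = T \<and> length xs = d"
      by blast
  qed
  finally show ?thesis .
qed

lemma card_nonempty_subsets_card_le:
  assumes "finite A"
  shows "card {T. T \<subseteq> A \<and> T \<noteq> {} \<and> card T \<le> d} = (\<Sum>p=1..d. card A choose p)"
proof -
  have "{T. T \<subseteq> A \<and> T \<noteq> {} \<and> card T \<le> d} = (\<Union>p\<in>{1..d}. {T. T \<subseteq> A \<and> card T = p})"
    using assms by (auto simp: Suc_le_eq card_gt_0_iff dest: finite_subset)
  also have "card \<dots> = (\<Sum>p=1..d. card {T. T \<subseteq> A \<and> card T = p})"
    using assms by (intro card_UN_disjoint) auto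
  finally show ?thesis
    using assms by (simp add: n_subsets)
qed

section \<open>Columns of the binary matrix as subsets\<close>

definition column_support :: "nat \<Rightarrow> real mat \<Rightarrow> nat \<Rightarrow> nat set" where
  "column_support n X j = {l. l < n \<and> X $$ (l, j) = 1}"

lemma binary_matrix_entry:
  assumes "binary_matrix n X" and "l < n" and "j < 2 ^ n - 1"
  shows "X $$ (l, j) = of_bool (l \<in> column_support n X j)"
  using assms by (auto simp: binary_matrix_def column_support_def)

lemma column_number:
  assumes "binary_matrix n X" and "j < 2 ^ n - 1"
  shows "j + 1 = (\<Sum>l\<in>column_support n X j. 2 ^ l)"
proof -
  have "real (j + 1) = (\<Sum>l<n. X $$ (l, j) * 2 ^ l)"
    using assms by (simp add: binary_matrix_def)
  also have "\<dots> = (\<Sum>l<n. of_bool (l \<in> column_support n X j) * 2 ^ l)"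
    using assms by (intro sum.cong) (auto simp: binary_matrix_entry)
  also have "\<dots> = (\<Sum>l\<in>column_support n X j. 2 ^ l)"
    by (intro sum.mono_neutral_cong_right) (auto simp: column_support_def)
  also have "\<dots> = real (\<Sum>l\<in>column_support n X j. 2 ^ l)"
    by simp
  finally show ?thesis
    by (simp only: of_nat_eq_iff)
qed

text \<open>
  A column is determined by its support, and there are as many columns as nonempty subsets of
  \<open>{..<n}\<close>.
\<close>

lemma bij_betw_column_support:
  assumes "binary_matrix n X"
  shows "bij_betw (column_support n X) {..<2 ^ n - 1} (Pow {..<n} - {{}})"
proof -
  have inj: "inj_on (column_support n X) {..<2 ^ n - 1}"
    by (rule inj_onI) (metis add_right_cancel assms column_number lessThan_iff)
  have sub: "column_support n X ` {..<2 ^ n - 1} \<subseteq> Pow {..<n} - {{}}"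
  proof clarsimp
    fix j :: nat
    assume j: "j < 2 ^ n - Suc 0"
    have "column_support n X j \<noteq> {}"
      using column_number[OF assms, of j] j by force
    then show "column_support n X j \<subseteq> {..<n} \<and> column_support n X j \<noteq> {}"
      by (auto simp: column_support_def)
  qed
  have "card (Pow {..<n} - {{}}) = 2 ^ n - 1"
    by (simp add: card_Diff_singleton card_Pow)
  then have "column_support n X ` {..<2 ^ n - 1} = Pow {..<n} - {{}}"
    using sub by (intro card_subset_eq) (simp_all only: card_image[OF inj] card_lessThan finite_Diff finite_Pow_iff finite_lessThan)
  with inj show ?thesis
    by (simp add: bij_betw_def)
qed

lemma column_support_mono:
  assumes "binary_matrix n X" and "i < 2 ^ n - 1" and "j < 2 ^ n - 1"
    and "column_support n X i \<subseteq> column_support n X j"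
  shows "i \<le> j"
proof -
  have "i + 1 \<le> j + 1"
    unfolding column_number[OF assms(1,2)] column_number[OF assms(1,3)]
    using assms(4) by (intro sum_mono2) (auto simp: column_support_def)
  then show ?thesis
    by simp
qed

lemma gram_entry:
  assumes "binary_matrix n X" and "i < 2 ^ n - 1" and "j < 2 ^ n - 1"
  shows "(X\<^sup>T * X) $$ (i, j) = card (column_support n X i \<inter> column_support n X j)"
proof -
  have "X \<in> carrier_mat n (2 ^ n - 1)"
    using assms(1) by (simp add: binary_matrix_def)
  then have "(X\<^sup>T * X) $$ (i, j) = (\<Sum>l<n. X $$ (l, i) * X $$ (l, j))"
    using assms(2,3) by (simp add: scalar_prod_def atLeast0LessThan)
  also have "\<dots> = (\<Sum>l<n. of_bool (l \<in> column_support n X i \<inter> column_support n X j))"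
    using assms by (intro sum.cong) (auto simp: binary_matrix_entry)
  also have "\<dots> = (\<Sum>l\<in>column_support n X i \<inter> column_support n X j. 1)"
    by (intro sum.mono_neutral_cong_right) (auto simp: column_support_def)
  finally show ?thesis
    by simp
qed

section \<open>The Hadamard power as a congruence\<close>

definition inclusion_matrix :: "nat \<Rightarrow> (nat \<Rightarrow> 'b set) \<Rightarrow> real mat" where
  "inclusion_matrix N S = mat N N (\<lambda>(t, j). of_bool (S t \<subseteq> S j))"

text \<open>If no set contains a later one, then the matrix is upper triangular with unit diagonal.\<close>

lemma det_inclusion_matrix:
  assumes "\<And>t j. t < N \<Longrightarrow> j < N \<Longrightarrow> S t \<subseteq> S j \<Longrightarrow> t \<le> j"
  shows "det (inclusion_matrix N S) = 1"
proof -
  have "upper_triangular (inclusion_matrix N S)"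
  proof (rule upper_triangularI)
    fix i j
    assume "j < i" and "i < dim_row (inclusion_matrix N S)"
    then show "inclusion_matrix N S $$ (i, j) = 0"
      using assms[of i j] by (auto simp: inclusion_matrix_def)
  qed
  then have "det (inclusion_matrix N S) = prod_list (diag_mat (inclusion_matrix N S))"
    by (rule det_upper_triangular[where n = N]) (simp add: inclusion_matrix_def)
  then show ?thesis
    by (simp add: prod_list_diag_prod inclusion_matrix_def)
qed

lemma hadamard_power_gram_congruent_diag:
  assumes X: "binary_matrix n X" and "d \<ge> 1"
  defines "N \<equiv> 2 ^ n - 1" and "S \<equiv> column_support n X"
  shows "hadamard_power (X\<^sup>T * X) d =
    (inclusion_matrix N S)\<^sup>T *
      (mat_diag N (\<lambda>t. real (words_onto d (S t))) * inclusion_matrix N S)" (is "_ = ?R")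
proof -
  have X': "X \<in> carrier_mat n N"
    using X by (simp add: binary_matrix_def N_def)
  have R: "?R = mat N N (\<lambda>(i, j). \<Sum>t<N. real (words_onto d (S t)) *
      inclusion_matrix N S $$ (t, i) * inclusion_matrix N S $$ (t, j))"
    by (rule congruent_diag_eq_mat) (simp add: inclusion_matrix_def)
  have "(X\<^sup>T * X) $$ (i, j) ^ d = ?R $$ (i, j)" if i: "i < N" and j: "j < N" for i j
  proof -
    have fin: "finite (S i \<inter> S j)"
      by (simp add: S_def column_support_def)
    have "(X\<^sup>T * X) $$ (i, j) ^ d = real (card (S i \<inter> S j) ^ d)"
      using gram_entry[OF X] i j by (simp add: N_def S_def)
    also have "\<dots> = (\<Sum>T\<in>Pow (S i \<inter> S j). real (words_onto d T))"
      by (simp only: card_power_eq_sum_words_onto[OF fin] of_nat_sum)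
    (* No word of length d > 0 has an empty set of letters, so T = {} contributes nothing;
       this is why the nonempty subsets suffice to index the rows. *)
    also have "\<dots> = (\<Sum>T\<in>Pow {..<n} - {{}}.
        real (words_onto d T) * of_bool (T \<subseteq> S i) * of_bool (T \<subseteq> S j))"
      using \<open>d \<ge> 1\<close>
      by (intro sum.mono_neutral_cong)
        (auto simp: S_def column_support_def words_onto_eq_0_iff)
    also have "\<dots> = (\<Sum>t<N. real (words_onto d (S t)) * of_bool (S t \<subseteq> S i) * of_bool (S t \<subseteq> S j))"
      using bij_betw_column_support[OF X] unfolding N_def S_def
      by (rule sum.reindex_bij_betw[symmetric])
    also have "\<dots> = ?R $$ (i, j)"
      unfolding R using i j by (simp add: inclusion_matrix_def)
    finally show ?thesis .
  qed
  then show ?thesis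
    using X' by (intro eq_matI) (auto simp: hadamard_power_def R)
qed

theorem theorem3p2:
  fixes n d :: nat and X K :: "real mat"
  assumes "n \<ge> 1"
    and "binary_matrix n X"
    and "K = X\<^sup>T * X"
    and "d \<ge> 1"
  shows "(d \<le> n \<longrightarrow>
            vec_space.rank (2 ^ n - 1) (hadamard_power K d) = (\<Sum>p=1..d. n choose p)) \<and>
         (d \<ge> n \<longrightarrow>
            vec_space.rank (2 ^ n - 1) (hadamard_power K d) = 2 ^ n - 1)"
proof -
  let ?N = "2 ^ n - 1 :: nat"
  let ?S = "column_support n X"
  let ?F = "{T. T \<subseteq> {..<n} \<and> T \<noteq> {} \<and> card T \<le> d}"
  have bij: "bij_betw ?S {..<?N} (Pow {..<n} - {{}})"
    by (rule bij_betw_column_support[OF assms(2)])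
  have "det (inclusion_matrix ?N ?S) = 1"
    using column_support_mono[OF assms(2)] by (rule det_inclusion_matrix)
  then have "vec_space.rank ?N (hadamard_power K d) =
      card {t. t < ?N \<and> real (words_onto d (?S t)) \<noteq> 0}"
    unfolding assms(3) hadamard_power_gram_congruent_diag[OF assms(2,4)]
    by (intro vec_space.rank_congruent_diag) (auto simp: inclusion_matrix_def)
  also have "\<dots> = card ?F"
  proof (rule bij_betw_same_card[of ?S])
    have "?S ` {t. t < ?N \<and> real (words_onto d (?S t)) \<noteq> 0} =
        {T \<in> ?S ` {..<?N}. words_onto d T \<noteq> 0}"
      by auto
    also have "\<dots> = {T \<in> Pow {..<n} - {{}}. words_onto d T \<noteq> 0}"
      using bij by (simp add: bij_betw_def)
    also have "\<dots> = ?F"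
    proof -
      have "words_onto d T \<noteq> 0 \<longleftrightarrow> T \<noteq> {} \<and> card T \<le> d" if "T \<subseteq> {..<n}" for T
        using words_onto_eq_0_iff[OF finite_subset[OF that finite_lessThan] assms(4)]
        by (simp add: not_less)
      then show ?thesis
        by (simp cong: conj_cong)
    qed
    finally show "bij_betw ?S {t. t < ?N \<and> real (words_onto d (?S t)) \<noteq> 0} ?F"
      using bij by (auto simp: bij_betw_def intro: inj_on_subset)
  qed
  finally have rank: "vec_space.rank ?N (hadamard_power K d) = card ?F" .
  show ?thesis
  proof (intro conjI impI)
    show "vec_space.rank ?N (hadamard_power K d) = (\<Sum>p=1..d. n choose p)"
      using rank card_nonempty_subsets_card_le[of "{..<n}" d] by simp
  next
    assume "n \<le> d"
    then have "card T \<le> d" if "T \<subseteq> {..<n}" for T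
      using card_mono[OF finite_lessThan that] by simp
    then have "?F = Pow {..<n} - {{}}"
      by blast
    then show "vec_space.rank ?N (hadamard_power K d) = ?N"
      using rank by (simp add: card_Diff_singleton card_Pow)
  qed
qed

end
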